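(* Let $S$ be a cancellative and right amenable monoid with group of left fractions $G=S^{-1}S$, let $\rho$ be a right $S$-action on a compact (Hausdorff) group $K$ by continuous endomorphisms, let $H\le K$ be a closed $S$-invariant subgroup, and let $\rho_H$ and $\rho_{K/H}$ be the right $S$-actions (by continuous endomorphisms, and by continuous self-maps, respectively) induced by $\rho$ on $H$ and on the space $K/H$ of left $H$-cosets. Denote by $\iota\colon H\to K$ the inclusion and by $\pi\colon K\to K/H$ the projection. Then: (1) $\iota^*\colon H^*\to K^*$ is an injective, $G$-equivariant, continuous and closed group homomorphism, i.e., the $G$-action $(\rho_H)^*$ on $H^*$ is conjugated to the action $(\rho^* )_{\iota^*(H^* )}$ obtained by restricting $\rho^*$ to $\iota^*(H^* )$; (2) $\pi^*\colon K^*\to(K/H)^*$ is a surjective, $G$-equivariant, continuous and open map; moreover, the $G$-action $(\rho_{K/H})^*$ on $(K/H)^*$ is conjugated to the action $(\rho^* )_{K^*/H^*}$ induced by $\rho^*$ on the space $K^*/H^*$ of left $H^*$-cosets (where $H^*$ is identified with $\iota^*(H^* )\le K^*$).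
   Context: A cancellative monoid $S$ is right amenable if it admits a right F{\o}lner net, i.e. a net $\{F_i\}_{i\in I}$ of non-empty finite subsets of $S$ such that $\lim_{i\in I}|F_is\setminus F_i|/|F_i|=0$ for every $s\in S$. Such an $S$ satisfies the left Ore condition and so embeds in its group of left fractions $G=S^{-1}S$, in which every element has the form $s^{-1}t$ with $s,t\in S$. Preorder $G$ by $g_1\le_S g_2$ iff $g_2^{-1}g_1\in S$; this is directed. A right $S$-action $\rho$ on a compact space $K$ is a family of continuous self-maps $\rho_s$ with $\rho_1=\mathrm{id}_K$, $\rho_{st}=\rho_t\circ\rho_s$; on a compact group the $\rho_s$ are required to be continuous endomorphisms (similarly for $G$). $H$ is $S$-invariant if $\rho_s(H)\subseteq H$ for all $s$; $(\rho_H)_s=\rho_s|_H$, $(\rho_{K/H})_s(kH)=\rho_s(k)H$. Two actions are conjugated if there is an equivariant isomorphism (topological group isomorphism for compact groups, homeomorphism for compact spaces) between the underlying objects. Ore colocalization of a right $S$-action $\rho$ on a compact space (or group) $K$: let $\bar K=\bigcap_{t\in S}\rho_t(K)$, $\bar\rho_s=\rho_s|_{\bar K}$; $K^*$ is the inverse limit of the inverse system indexed by $(G,\le_S)$ with $K_g=\bar K$ ($g\in G$) and transition maps $\bar\rho_s\colon K_g\to K_{gs}$ ($g\in G,s\in S$), with canonical maps $\pi_g^K\colon K^*\to\bar K$; $\rho^*$ is the right $G$-action on $K^*$ such that $\pi^K_h\circ\rho_g^*=\pi^K_{gh}$ for all $g,h\in G$. If $K$ is a compact group then so is $K^*$, and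 $\rho^*$ is by continuous automorphisms. For an $S$-equivariant continuous map $\phi\colon K\to K'$, with restriction $\bar\phi\colon\bar K\to\bar K'$, $\phi^*\colon K^*\to(K')^*$ is the unique continuous map with $\pi_g^{K'}\circ\phi^*=\bar\phi\circ\pi_g^K$ for all $g\in G$. *)

theory Defs
  imports
    "HOL-Analysis.Analysis"
    "HOL-Algebra.Divisibility"
    "HOL-Algebra.Left_Coset"
    "HOL-Algebra.Product_Groups"
begin

section \<open>Amenable monoids and groups of left fractions\<close>

text \<open>Convergence along a net indexed by a directed preorder is convergence along its filter of
  tails.\<close>

definition directed_preorder :: "'i set \<Rightarrow> ('i \<Rightarrow> 'i \<Rightarrow> bool) \<Rightarrow> bool" where
  "directed_preorder I preceq \<longleftrightarrow>
     I \<noteq> {} \<and>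
     (\<forall>i\<in>I. preceq i i) \<and>
     (\<forall>i\<in>I. \<forall>j\<in>I. \<forall>k\<in>I. preceq i j \<longrightarrow> preceq j k \<longrightarrow> preceq i k) \<and>
     (\<forall>i\<in>I. \<forall>j\<in>I. \<exists>k\<in>I. preceq i k \<and> preceq j k)"

definition tails_filter :: "'i set \<Rightarrow> ('i \<Rightarrow> 'i \<Rightarrow> bool) \<Rightarrow> 'i filter" where
  "tails_filter I preceq = (INF i\<in>I. principal {j\<in>I. preceq i j})"

definition right_Folner_net ::
  "('s, 'm) monoid_scheme \<Rightarrow> 'i set \<Rightarrow> ('i \<Rightarrow> 'i \<Rightarrow> bool) \<Rightarrow> ('i \<Rightarrow> 's set) \<Rightarrow> bool" where
  "right_Folner_net S I preceq F \<longleftrightarrow>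
     directed_preorder I preceq \<and>
     (\<forall>i\<in>I. finite (F i) \<and> F i \<noteq> {} \<and> F i \<subseteq> carrier S) \<and>
     (\<forall>s\<in>carrier S.
        ((\<lambda>i. real (card ((F i #>\<^bsub>S\<^esub> s) - F i)) / real (card (F i))) \<longlongrightarrow> 0) (tails_filter I preceq))"

text \<open>The map \<open>j\<close> is the embedding of \<open>S\<close> into \<open>G\<close>; it determines \<open>G\<close> up to an
  isomorphism under \<open>S\<close>.\<close>

definition group_of_left_fractions ::
  "('s, 'm) monoid_scheme \<Rightarrow> ('g, 'n) monoid_scheme \<Rightarrow> ('s \<Rightarrow> 'g) \<Rightarrow> bool" where
  "group_of_left_fractions S G j \<longleftrightarrow>
     group G \<and> j \<in> hom S G \<and> inj_on j (carrier S) \<and>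
     carrier G = {inv\<^bsub>G\<^esub> (j s) \<otimes>\<^bsub>G\<^esub> j t | s t. s \<in> carrier S \<and> t \<in> carrier S}"


section \<open>Right actions on compact spaces and compact groups\<close>

locale compact_group = group K for K (structure) +
  fixes T :: "'a topology"
  assumes topspace_eq: "topspace T = carrier K"
    and continuous_mult: "continuous_map (prod_topology T T) T (\<lambda>(x, y). x \<otimes> y)"
    and continuous_inv: "continuous_map T T (\<lambda>x. inv x)"
    and compact: "compact_space T"
    and Hausdorff: "Hausdorff_space T"

definition right_action ::
  "('s, 'm) monoid_scheme \<Rightarrow> 'k topology \<Rightarrow> ('s \<Rightarrow> 'k \<Rightarrow> 'k) \<Rightarrow> bool" where
  "right_action S X \<rho> \<longleftrightarrow>
     compact_space X \<and> Hausdorff_space X \<and>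
     (\<forall>s\<in>carrier S. continuous_map X X (\<rho> s)) \<and>
     (\<forall>x\<in>topspace X. \<rho> \<one>\<^bsub>S\<^esub> x = x) \<and>
     (\<forall>s\<in>carrier S. \<forall>t\<in>carrier S. \<forall>x\<in>topspace X. \<rho> (s \<otimes>\<^bsub>S\<^esub> t) x = \<rho> t (\<rho> s x))"

definition right_group_action ::
  "('s, 'm) monoid_scheme \<Rightarrow> ('k, 'n) monoid_scheme \<Rightarrow> 'k topology \<Rightarrow> ('s \<Rightarrow> 'k \<Rightarrow> 'k) \<Rightarrow> bool" where
  "right_group_action S K T \<rho> \<longleftrightarrow>
     compact_group K T \<and> right_action S T \<rho> \<and> (\<forall>s\<in>carrier S. \<rho> s \<in> hom K K)"

definition action_invariant ::
  "('s, 'm) monoid_scheme \<Rightarrow> ('s \<Rightarrow> 'k \<Rightarrow> 'k) \<Rightarrow> 'k set \<Rightarrow> bool" where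
  "action_invariant S \<rho> A \<longleftrightarrow> (\<forall>s\<in>carrier S. \<rho> s ` A \<subseteq> A)"

definition equivariant ::
  "('s, 'm) monoid_scheme \<Rightarrow> 'x topology \<Rightarrow> ('s \<Rightarrow> 'x \<Rightarrow> 'x) \<Rightarrow> ('s \<Rightarrow> 'y \<Rightarrow> 'y) \<Rightarrow> ('x \<Rightarrow> 'y) \<Rightarrow> bool" where
  "equivariant S X \<alpha> \<beta> f \<longleftrightarrow> (\<forall>s\<in>carrier S. \<forall>x\<in>topspace X. f (\<alpha> s x) = \<beta> s (f x))"

text \<open>Conjugacy is only asserted between actions: that both sides are actions (in particular that
  the underlying objects are compact Hausdorff spaces, respectively compact groups) is part of it.\<close>

definition conjugated ::
  "('s, 'm) monoid_scheme \<Rightarrow> 'x topology \<Rightarrow> ('s \<Rightarrow> 'x \<Rightarrow> 'x) \<Rightarrow>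
   'y topology \<Rightarrow> ('s \<Rightarrow> 'y \<Rightarrow> 'y) \<Rightarrow> bool" where
  "conjugated S X \<alpha> Y \<beta> \<longleftrightarrow>
     right_action S X \<alpha> \<and> right_action S Y \<beta> \<and>
     (\<exists>f. homeomorphic_map X Y f \<and> equivariant S X \<alpha> \<beta> f)"

definition group_conjugated ::
  "('s, 'm) monoid_scheme \<Rightarrow> ('x, 'n) monoid_scheme \<Rightarrow> 'x topology \<Rightarrow> ('s \<Rightarrow> 'x \<Rightarrow> 'x) \<Rightarrow>
   ('y, 'p) monoid_scheme \<Rightarrow> 'y topology \<Rightarrow> ('s \<Rightarrow> 'y \<Rightarrow> 'y) \<Rightarrow> bool" where
  "group_conjugated S K X \<alpha> L Y \<beta> \<longleftrightarrow>
     right_group_action S K X \<alpha> \<and> right_group_action S L Y \<beta> \<and>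
     (\<exists>f. f \<in> iso K L \<and> homeomorphic_map X Y f \<and> equivariant S X \<alpha> \<beta> f)"

definition restrict_action :: "('s \<Rightarrow> 'k \<Rightarrow> 'k) \<Rightarrow> 'k set \<Rightarrow> 's \<Rightarrow> 'k \<Rightarrow> 'k" where
  "restrict_action \<rho> A = (\<lambda>s. restrict (\<rho> s) A)"


section \<open>Spaces of left cosets\<close>

definition coset_space :: "('k, 'n) monoid_scheme \<Rightarrow> 'k topology \<Rightarrow> 'k set \<Rightarrow> 'k set topology" where
  "coset_space K T H = topology (\<lambda>U.
     U \<subseteq> lcosets\<^bsub>K\<^esub> H \<and> openin T {k \<in> topspace T. k <#\<^bsub>K\<^esub> H \<in> U})"

text \<open>The map \<open>kH \<mapsto> \<rho>\<^sub>s(k)H\<close>, written without choosing representatives;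
  see \<open>coset_action_coset\<close> below.\<close>

definition coset_action ::
  "('k, 'n) monoid_scheme \<Rightarrow> 'k set \<Rightarrow> ('s \<Rightarrow> 'k \<Rightarrow> 'k) \<Rightarrow> 's \<Rightarrow> 'k set \<Rightarrow> 'k set" where
  "coset_action K H \<rho> s A = (\<rho> s ` A) <#>\<^bsub>K\<^esub> H"

lemma openin_coset_space:
  "openin (coset_space K T H) U \<longleftrightarrow>
     U \<subseteq> lcosets\<^bsub>K\<^esub> H \<and> openin T {k \<in> topspace T. k <#\<^bsub>K\<^esub> H \<in> U}"
proof -
  let ?P = "\<lambda>U. U \<subseteq> lcosets\<^bsub>K\<^esub> H \<and> openin T {k \<in> topspace T. k <#\<^bsub>K\<^esub> H \<in> U}"
  have "istopology ?P"
    unfolding istopology_def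
  proof (intro conjI allI impI)
    fix U V assume U: "?P U" and V: "?P V"
    show "U \<inter> V \<subseteq> lcosets\<^bsub>K\<^esub> H" using U by blast
    have "{k \<in> topspace T. k <#\<^bsub>K\<^esub> H \<in> U \<inter> V} =
        {k \<in> topspace T. k <#\<^bsub>K\<^esub> H \<in> U} \<inter> {k \<in> topspace T. k <#\<^bsub>K\<^esub> H \<in> V}" by blast
    then show "openin T {k \<in> topspace T. k <#\<^bsub>K\<^esub> H \<in> U \<inter> V}"
      using U V by (metis (no_types, lifting) openin_Int)
  next
    fix \<U> assume \<U>: "\<forall>U\<in>\<U>. ?P U"
    show "\<Union>\<U> \<subseteq> lcosets\<^bsub>K\<^esub> H" using \<U> by blast
    have "{k \<in> topspace T. k <#\<^bsub>K\<^esub> H \<in> \<Union>\<U>} =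
        (\<Union>U\<in>\<U>. {k \<in> topspace T. k <#\<^bsub>K\<^esub> H \<in> U})" by blast
    moreover have "openin T (\<Union>U\<in>\<U>. {k \<in> topspace T. k <#\<^bsub>K\<^esub> H \<in> U})"
      using \<U> by (intro openin_Union) auto
    ultimately show "openin T {k \<in> topspace T. k <#\<^bsub>K\<^esub> H \<in> \<Union>\<U>}" by simp
  qed
  then show ?thesis
    unfolding coset_space_def by (simp add: topology_inverse')
qed

lemma topspace_coset_space:
  assumes "topspace T = carrier K"
  shows "topspace (coset_space K T H) = lcosets\<^bsub>K\<^esub> H"
proof
  show "topspace (coset_space K T H) \<subseteq> lcosets\<^bsub>K\<^esub> H"
    using openin_coset_space openin_topspace by blast
  have "{k \<in> topspace T. k <#\<^bsub>K\<^esub> H \<in> lcosets\<^bsub>K\<^esub> H} = topspace T"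
    using assms by (auto simp: LCOSETS_def)
  then have "openin (coset_space K T H) (lcosets\<^bsub>K\<^esub> H)"
    by (simp add: openin_coset_space)
  then show "lcosets\<^bsub>K\<^esub> H \<subseteq> topspace (coset_space K T H)"
    by (rule openin_subset)
qed

lemma quotient_map_coset_space:
  assumes "topspace T = carrier K"
  shows "quotient_map T (coset_space K T H) (\<lambda>k. k <#\<^bsub>K\<^esub> H)"
  unfolding quotient_map_def topspace_coset_space[OF assms] openin_coset_space
  using assms by (auto simp: LCOSETS_def)

lemma coset_action_coset:
  assumes "group K" "subgroup H K" "\<rho> s \<in> hom K K" "\<rho> s ` H \<subseteq> H" "k \<in> carrier K"
  shows "coset_action K H \<rho> s (k <#\<^bsub>K\<^esub> H) = \<rho> s k <#\<^bsub>K\<^esub> H"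
proof -
  interpret group K by fact
  interpret H: subgroup H K by fact
  have \<rho>k: "\<rho> s k \<in> carrier K"
    using assms by (auto simp: hom_def)
  have \<rho>m: "\<rho> s (k \<otimes>\<^bsub>K\<^esub> h) = \<rho> s k \<otimes>\<^bsub>K\<^esub> \<rho> s h" if "h \<in> H" for h
    using assms that by (auto simp: hom_def)
  have \<rho>h: "\<rho> s h \<in> H" if "h \<in> H" for h using assms that by blast
  show ?thesis
  proof (intro equalityI subsetI)
    fix x assume "x \<in> coset_action K H \<rho> s (k <#\<^bsub>K\<^esub> H)"
    then obtain h h' where h: "h \<in> H" "h' \<in> H" and x: "x = \<rho> s (k \<otimes>\<^bsub>K\<^esub> h) \<otimes>\<^bsub>K\<^esub> h'"
      by (auto simp: coset_action_def set_mult_def l_coset_def)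
    have "x = \<rho> s k \<otimes>\<^bsub>K\<^esub> (\<rho> s h \<otimes>\<^bsub>K\<^esub> h')"
      using x h \<rho>k \<rho>m \<rho>h by (simp add: m_assoc)
    moreover have "\<rho> s h \<otimes>\<^bsub>K\<^esub> h' \<in> H" using h \<rho>h by simp
    ultimately show "x \<in> \<rho> s k <#\<^bsub>K\<^esub> H" by (auto simp: l_coset_def)
  next
    fix x assume "x \<in> \<rho> s k <#\<^bsub>K\<^esub> H"
    then obtain h where h: "h \<in> H" "x = \<rho> s k \<otimes>\<^bsub>K\<^esub> h" by (auto simp: l_coset_def)
    have "k \<in> k <#\<^bsub>K\<^esub> H" using lcos_self assms by blast
    then show "x \<in> coset_action K H \<rho> s (k <#\<^bsub>K\<^esub> H)"
      using h by (auto simp: coset_action_def set_mult_def)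
  qed
qed


section \<open>Ore colocalization\<close>

definition Ore_core ::
  "('s, 'm) monoid_scheme \<Rightarrow> 'k topology \<Rightarrow> ('s \<Rightarrow> 'k \<Rightarrow> 'k) \<Rightarrow> 'k set" where
  "Ore_core S X \<rho> = (\<Inter>t\<in>carrier S. \<rho> t ` topspace X)"

text \<open>The inverse limit, over \<open>G\<close> preordered by \<open>g\<^sub>1 \<le> g\<^sub>2\<close> iff \<open>g\<^sub>2\<inverse>g\<^sub>1 \<in> j(S)\<close>, of copies
  of the core, realised as the subspace of compatible families in the product. The pairs
  \<open>h \<le> g\<close> are exactly those with \<open>h = g j(s)\<close> for a (unique) \<open>s\<close>, and the transition map
  from index \<open>g\<close> to index \<open>g j(s)\<close> is \<open>\<rho> s\<close>. The canonical map \<open>\<pi>\<^sub>g\<close> is evaluation at \<open>g\<close>.\<close>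

definition colocal_space ::
  "('s, 'm) monoid_scheme \<Rightarrow> ('g, 'n) monoid_scheme \<Rightarrow> ('s \<Rightarrow> 'g) \<Rightarrow>
   'k topology \<Rightarrow> ('s \<Rightarrow> 'k \<Rightarrow> 'k) \<Rightarrow> ('g \<Rightarrow> 'k) topology" where
  "colocal_space S G j X \<rho> =
     subtopology
       (product_topology (\<lambda>g. subtopology X (Ore_core S X \<rho>)) (carrier G))
       {x. \<forall>g\<in>carrier G. \<forall>s\<in>carrier S. \<rho> s (x g) = x (g \<otimes>\<^bsub>G\<^esub> j s)}"

definition colocal_group ::
  "('s, 'm) monoid_scheme \<Rightarrow> ('g, 'n) monoid_scheme \<Rightarrow> ('s \<Rightarrow> 'g) \<Rightarrow>
   ('k, 'p) monoid_scheme \<Rightarrow> 'k topology \<Rightarrow> ('s \<Rightarrow> 'k \<Rightarrow> 'k) \<Rightarrow> ('g \<Rightarrow> 'k) monoid" where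
  "colocal_group S G j K T \<rho> =
     (product_group (carrier G) (\<lambda>g. K))\<lparr>carrier := topspace (colocal_space S G j T \<rho>)\<rparr>"

text \<open>\<open>\<rho>\<^sup>*\<close> does not depend on \<open>\<rho>\<close> except through its domain: the condition
  \<open>\<pi>\<^sub>h \<circ> \<rho>\<^sup>*\<^sub>g = \<pi>\<^sub>g\<^sub>h\<close> says that \<open>g\<close> acts by shifting the index.\<close>

definition colocal_action ::
  "('g, 'n) monoid_scheme \<Rightarrow> 'g \<Rightarrow> ('g \<Rightarrow> 'k) \<Rightarrow> ('g \<Rightarrow> 'k)" where
  "colocal_action G g x = (\<lambda>h\<in>carrier G. x (g \<otimes>\<^bsub>G\<^esub> h))"

definition colocal_map ::
  "('g, 'n) monoid_scheme \<Rightarrow> ('k \<Rightarrow> 'l) \<Rightarrow> ('g \<Rightarrow> 'k) \<Rightarrow> ('g \<Rightarrow> 'l)" where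
  "colocal_map G \<phi> x = (\<lambda>g\<in>carrier G. \<phi> (x g))"

end

theory Submission
  imports Defs
begin

text \<open>Every compatible family already takes its values in the core, so the colocalization of a
  compact space is the closed set of compatible families in a power of it; for an invariant closed
  subgroup \<open>H\<close>, it is the subgroup of those families in \<open>K\<^sup>*\<close> that take values in \<open>H\<close>. In a group of
  left fractions finitely many elements are of the form \<open>k j(s\<^sub>i)\<close> with a common \<open>k\<close>, so by
  compactness every compatible family of cosets lifts to a compatible family of elements of \<open>K\<close>.
  Hence \<open>\<pi>\<^sup>*\<close> induces a continuous bijection from the compact space \<open>K\<^sup>*/H\<^sup>*\<close> to the Hausdorff space
  \<open>(K/H)\<^sup>*\<close>, which is a homeomorphism; as the projection to \<open>K\<^sup>*/H\<^sup>*\<close> is open, so is \<open>\<pi>\<^sup>*\<close>.\<close>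

section \<open>Directedness in a group of left fractions\<close>

locale left_fractions = S: monoid S + G: group G
  for S :: "('s, 'm) monoid_scheme" (structure) and G :: "('g, 'n) monoid_scheme" (structure) +
  fixes j :: "'s \<Rightarrow> 'g"
  assumes fractions: "group_of_left_fractions S G j"
begin

lemma j_closed [simp]: "s \<in> carrier S \<Longrightarrow> j s \<in> carrier G"
  using fractions by (auto simp: group_of_left_fractions_def hom_def)

lemma j_mult: "s \<in> carrier S \<Longrightarrow> t \<in> carrier S \<Longrightarrow> j (s \<otimes>\<^bsub>S\<^esub> t) = j s \<otimes>\<^bsub>G\<^esub> j t"
  using fractions by (auto simp: group_of_left_fractions_def hom_def)

lemma j_inj: "s \<in> carrier S \<Longrightarrow> t \<in> carrier S \<Longrightarrow> j s = j t \<longleftrightarrow> s = t"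
  using fractions by (auto simp: group_of_left_fractions_def inj_on_def)

text \<open>\<open>hom\<close> demands multiplicativity only, so \<open>j\<close> sends the unit to
  an idempotent; in a group the only idempotent is the unit.\<close>

lemma j_one: "j \<one>\<^bsub>S\<^esub> = \<one>\<^bsub>G\<^esub>"
proof -
  have "j \<one>\<^bsub>S\<^esub> \<otimes>\<^bsub>G\<^esub> j \<one>\<^bsub>S\<^esub> = j \<one>\<^bsub>S\<^esub>"
    using j_mult[of "\<one>\<^bsub>S\<^esub>" "\<one>\<^bsub>S\<^esub>"] by simp
  then show ?thesis by simp
qed

lemma fraction_cases:
  assumes "g \<in> carrier G"
  obtains s t where "s \<in> carrier S" "t \<in> carrier S" "g = inv\<^bsub>G\<^esub> j s \<otimes>\<^bsub>G\<^esub> j t"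
  using fractions assms unfolding group_of_left_fractions_def by blast

text \<open>If \<open>inv g \<otimes> h\<close> is the fraction
  \<open>inv j u \<otimes> j v\<close>, then \<open>k = g \<otimes> inv j u\<close> works. With
  respect to the preorder \<open>\<le>_S\<close>, in which \<open>k \<otimes> j s\<close> lies below
  \<open>k\<close>, this \<open>k\<close> is an upper bound: transition maps lead from
  \<open>k\<close> to both \<open>g\<close> and \<open>h\<close>.\<close>

lemma common_lower_bound2:
  assumes "g \<in> carrier G" "h \<in> carrier G"
  obtains k s t where "k \<in> carrier G" "s \<in> carrier S" "t \<in> carrier S"
    "g = k \<otimes>\<^bsub>G\<^esub> j s" "h = k \<otimes>\<^bsub>G\<^esub> j t"
proof -
  have "inv\<^bsub>G\<^esub> g \<otimes>\<^bsub>G\<^esub> h \<in> carrier G" using assms by simp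
  then obtain u v where uv: "u \<in> carrier S" "v \<in> carrier S" "inv\<^bsub>G\<^esub> g \<otimes>\<^bsub>G\<^esub> h = inv\<^bsub>G\<^esub> j u \<otimes>\<^bsub>G\<^esub> j v"
    by (rule fraction_cases)
  show ?thesis
  proof
    show "g \<otimes>\<^bsub>G\<^esub> inv\<^bsub>G\<^esub> j u \<in> carrier G" "u \<in> carrier S" "v \<in> carrier S"
      using uv assms by auto
    show "g = g \<otimes>\<^bsub>G\<^esub> inv\<^bsub>G\<^esub> j u \<otimes>\<^bsub>G\<^esub> j u"
      using uv assms by (simp add: G.m_assoc)
    have "h = g \<otimes>\<^bsub>G\<^esub> (inv\<^bsub>G\<^esub> g \<otimes>\<^bsub>G\<^esub> h)"
      using assms by (simp add: G.m_assoc[symmetric])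
    then show "h = g \<otimes>\<^bsub>G\<^esub> inv\<^bsub>G\<^esub> j u \<otimes>\<^bsub>G\<^esub> j v"
      using uv assms by (simp add: G.m_assoc)
  qed
qed

text \<open>Induction: the bound \<open>k\<close> found so far and the new element \<open>g\<close>
  are both multiples of some \<open>l\<close>, and \<open>k = l \<otimes> j s\<close> turns
  \<open>k \<otimes> j r\<close> into \<open>l \<otimes> j (s \<otimes> r)\<close>. This is the
  directedness behind the finite intersection argument in \<open>colocal_selection\<close>.\<close>

lemma common_lower_bound:
  assumes "finite A" "A \<subseteq> carrier G"
  shows "\<exists>k\<in>carrier G. \<forall>g\<in>A. \<exists>s\<in>carrier S. g = k \<otimes>\<^bsub>G\<^esub> j s"
  using assms
proof (induction A)
  case empty
  then show ?case by (auto intro: G.one_closed)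
next
  case (insert g A)
  then obtain k where k: "k \<in> carrier G" "\<And>h. h \<in> A \<Longrightarrow> \<exists>s\<in>carrier S. h = k \<otimes>\<^bsub>G\<^esub> j s"
    by auto
  obtain l s t where l: "l \<in> carrier G" "s \<in> carrier S" "t \<in> carrier S"
      "k = l \<otimes>\<^bsub>G\<^esub> j s" "g = l \<otimes>\<^bsub>G\<^esub> j t"
    using common_lower_bound2[OF k(1)] insert.prems by (metis insert_subset)
  have "\<exists>s\<in>carrier S. h = l \<otimes>\<^bsub>G\<^esub> j s" if "h \<in> A" for h
  proof -
    obtain r where "r \<in> carrier S" "h = k \<otimes>\<^bsub>G\<^esub> j r" using k(2)[OF \<open>h \<in> A\<close>] by blast
    then have "s \<otimes>\<^bsub>S\<^esub> r \<in> carrier S" "h = l \<otimes>\<^bsub>G\<^esub> j (s \<otimes>\<^bsub>S\<^esub> r)"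
      using l by (simp_all add: j_mult G.m_assoc)
    then show ?thesis by blast
  qed
  then have "\<forall>h\<in>insert g A. \<exists>s\<in>carrier S. h = l \<otimes>\<^bsub>G\<^esub> j s" using l by blast
  then show ?case using l(1) by blast
qed

section \<open>The colocalization as a compact space with a group action\<close>

text \<open>The core is redundant in the inverse limit: a compatible family satisfies
  \<open>x g = \<rho> t (x (g \<otimes> inv (j t)))\<close> for every \<open>t\<close>.\<close>

lemma colocal_space_eq:
  "colocal_space S G j X \<rho> =
     subtopology (product_topology (\<lambda>_. X) (carrier G))
       {x. \<forall>g\<in>carrier G. \<forall>s\<in>carrier S. \<rho> s (x g) = x (g \<otimes>\<^bsub>G\<^esub> j s)}"
proof -
  let ?C = "{x. \<forall>g\<in>carrier G. \<forall>s\<in>carrier S. \<rho> s (x g) = x (g \<otimes>\<^bsub>G\<^esub> j s)}"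
  let ?P = "product_topology (\<lambda>_. X) (carrier G)"
  let ?E = "carrier G \<rightarrow>\<^sub>E Ore_core S X \<rho>"
  have "x g \<in> Ore_core S X \<rho>" if x: "x \<in> topspace ?P" "x \<in> ?C" and g: "g \<in> carrier G" for x g
    unfolding Ore_core_def
  proof
    fix t assume t: "t \<in> carrier S"
    then have "x g = \<rho> t (x (g \<otimes>\<^bsub>G\<^esub> inv\<^bsub>G\<^esub> j t))"
      using x g by (simp add: G.m_assoc)
    moreover have "x (g \<otimes>\<^bsub>G\<^esub> inv\<^bsub>G\<^esub> j t) \<in> topspace X"
      using x g t by (auto simp: PiE_iff)
    ultimately show "x g \<in> \<rho> t ` topspace X" by blast
  qed
  then have "topspace ?P \<inter> (?E \<inter> ?C) = topspace ?P \<inter> ?C"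
    by (auto simp: PiE_iff)
  then have "subtopology ?P (?E \<inter> ?C) = subtopology ?P ?C"
    \<comment> \<open>A subtopology depends only on the trace of the set on the whole space, so both
      sets are first cut down to \<open>topspace ?P\<close>, where they agree.\<close>
    by (subst (1 2) subtopology_restrict[symmetric]) (simp only:)
  then show ?thesis
    unfolding colocal_space_def subtopology_product_topology[symmetric] subtopology_subtopology .
qed

lemma topspace_colocal_space:
  "x \<in> topspace (colocal_space S G j X \<rho>) \<longleftrightarrow>
     x \<in> carrier G \<rightarrow>\<^sub>E topspace X \<and>
     (\<forall>g\<in>carrier G. \<forall>s\<in>carrier S. \<rho> s (x g) = x (g \<otimes>\<^bsub>G\<^esub> j s))"
  unfolding colocal_space_eq by simp

lemma continuous_map_colocal_eval:
  "g \<in> carrier G \<Longrightarrow> continuous_map (colocal_space S G j X \<rho>) X (\<lambda>x. x g)"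
  unfolding colocal_space_eq
  by (intro continuous_map_from_subtopology continuous_map_product_projection)

lemma continuous_map_into_colocal_space:
  assumes "\<And>z. z \<in> topspace Z \<Longrightarrow> f z \<in> topspace (colocal_space S G j X \<rho>)"
    and "\<And>g. g \<in> carrier G \<Longrightarrow> continuous_map Z X (\<lambda>z. f z g)"
  shows "continuous_map Z (colocal_space S G j X \<rho>) f"
  using assms unfolding topspace_colocal_space unfolding colocal_space_eq
  by (auto simp: continuous_map_in_subtopology continuous_map_componentwise PiE_iff)

text \<open>Each compatibility relation says that two continuous maps into the Hausdorff space
  \<open>X\<close> agree, hence is a closed condition on the product.\<close>

lemma closedin_colocal_space:
  assumes "right_action S X \<rho>"
  shows "closedin (product_topology (\<lambda>_. X) (carrier G)) (topspace (colocal_space S G j X \<rho>))"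
proof -
  let ?P = "product_topology (\<lambda>_. X) (carrier G)"
  let ?D = "\<lambda>g s. {x \<in> topspace ?P. \<rho> s (x g) = x (g \<otimes>\<^bsub>G\<^esub> j s)}"
  have "closedin ?P (?D g s)" if "g \<in> carrier G" "s \<in> carrier S" for g s
  proof (rule closedin_continuous_maps_eq)
    show "Hausdorff_space X" using assms by (simp add: right_action_def)
    have "continuous_map ?P X (\<rho> s \<circ> (\<lambda>x. x g))"
      using assms that
      by (intro continuous_map_compose[OF continuous_map_product_projection])
        (auto simp: right_action_def)
    then show "continuous_map ?P X (\<lambda>x. \<rho> s (x g))" by (simp add: o_def)
    show "continuous_map ?P X (\<lambda>x. x (g \<otimes>\<^bsub>G\<^esub> j s))"
      using that by (intro continuous_map_product_projection) simp
  qed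
  then have "closedin ?P (\<Inter>(g, s)\<in>carrier G \<times> carrier S. ?D g s)"
    by (intro closedin_Inter) (use G.one_closed S.one_closed in \<open>auto simp del: topspace_product_topology\<close>)
  moreover have "(\<Inter>(g, s)\<in>carrier G \<times> carrier S. ?D g s) = topspace (colocal_space S G j X \<rho>)"
    using G.one_closed S.one_closed by (auto simp: set_eq_iff topspace_colocal_space PiE_iff)
  ultimately show ?thesis by simp
qed

lemma compact_colocal_space:
  assumes "right_action S X \<rho>"
  shows "compact_space (colocal_space S G j X \<rho>)"
proof -
  let ?P = "product_topology (\<lambda>_. X) (carrier G)"
  have "compact_space ?P"
    using assms by (simp add: compact_space_product_topology right_action_def)
  then have "compactin ?P (topspace (colocal_space S G j X \<rho>))"
    using closedin_colocal_space[OF assms] by (rule closedin_compact_space)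
  then have "compact_space (subtopology ?P (topspace (colocal_space S G j X \<rho>)))"
    by (rule compact_space_subtopology)
  then show ?thesis
    unfolding colocal_space_eq topspace_subtopology subtopology_restrict .
qed

lemma Hausdorff_colocal_space:
  assumes "Hausdorff_space X"
  shows "Hausdorff_space (colocal_space S G j X \<rho>)"
  unfolding colocal_space_eq
  using assms by (intro Hausdorff_space_subtopology) (simp add: Hausdorff_space_product_topology)

text \<open>Compatibility links \<open>g\<close> with \<open>g \<otimes> j s\<close>, a right
  multiplication, and the action shifts indices by left multiplication; the two commute.\<close>

lemma colocal_action_closed:
  assumes "g \<in> carrier G" "x \<in> topspace (colocal_space S G j X \<rho>)"
  shows "colocal_action G g x \<in> topspace (colocal_space S G j X \<rho>)"
  using assms by (auto simp: topspace_colocal_space colocal_action_def PiE_iff G.m_assoc)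

lemma right_action_colocal:
  assumes "right_action S X \<rho>"
  shows "right_action G (colocal_space S G j X \<rho>) (colocal_action G)"
  unfolding right_action_def
proof (intro conjI ballI)
  show "compact_space (colocal_space S G j X \<rho>)" by (rule compact_colocal_space[OF assms])
  show "Hausdorff_space (colocal_space S G j X \<rho>)"
    using assms by (intro Hausdorff_colocal_space) (simp add: right_action_def)
next
  fix g assume "g \<in> carrier G"
  then show "continuous_map (colocal_space S G j X \<rho>) (colocal_space S G j X \<rho>) (colocal_action G g)"
    by (intro continuous_map_into_colocal_space colocal_action_closed)
      (auto simp: colocal_action_def continuous_map_colocal_eval)
next
  fix x assume x: "x \<in> topspace (colocal_space S G j X \<rho>)"
  then show "colocal_action G \<one>\<^bsub>G\<^esub> x = x"
    by (auto simp: colocal_action_def topspace_colocal_space PiE_iff extensional_def)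
  show "colocal_action G (g \<otimes>\<^bsub>G\<^esub> h) x = colocal_action G h (colocal_action G g x)"
    if "g \<in> carrier G" "h \<in> carrier G" for g h
    using that by (auto simp: colocal_action_def G.m_assoc)
qed

text \<open>A compactness argument: the conditions attached to one index are closed and satisfiable,
  and finitely many of them follow from those at a single index. It will be applied to the fibres
  over a compatible family of cosets.\<close>

lemma colocal_selection:
  assumes \<rho>: "right_action S X \<rho>"
    and Y: "\<And>g. g \<in> carrier G \<Longrightarrow> closedin X (Y g)" "\<And>g. g \<in> carrier G \<Longrightarrow> Y g \<noteq> {}"
    and inv: "\<And>g s. g \<in> carrier G \<Longrightarrow> s \<in> carrier S \<Longrightarrow> \<rho> s ` Y g \<subseteq> Y (g \<otimes>\<^bsub>G\<^esub> j s)"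
  shows "\<exists>x\<in>topspace (colocal_space S G j X \<rho>). \<forall>g\<in>carrier G. x g \<in> Y g"
proof -
  let ?P = "product_topology (\<lambda>_. X) (carrier G)"
  \<comment> \<open>Only the relations that start at the index \<open>g\<close> are imposed, so that
    a member can be built from one point of \<open>Y g\<close>; the intersection over all
    \<open>g\<close> is the set of compatible selections.\<close>
  define A where "A g = {x \<in> topspace ?P. x g \<in> Y g} \<inter>
    (\<Inter>s\<in>carrier S. {x \<in> topspace ?P. \<rho> s (x g) = x (g \<otimes>\<^bsub>G\<^esub> j s)})" for g
  have cont: "continuous_map X X (\<rho> s)" if "s \<in> carrier S" for s
    using \<rho> that by (simp add: right_action_def)
  have closed: "closedin ?P (A g)" if g: "g \<in> carrier G" for g
    unfolding A_def
  proof (intro closedin_Int closedin_INT)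
    show "closedin ?P {x \<in> topspace ?P. x g \<in> Y g}"
      using closedin_continuous_map_preimage[OF continuous_map_product_projection[OF g] Y(1)[OF g]] .
    show "carrier S \<noteq> {}" using S.one_closed by blast
    fix s assume s: "s \<in> carrier S"
    show "closedin ?P {x \<in> topspace ?P. \<rho> s (x g) = x (g \<otimes>\<^bsub>G\<^esub> j s)}"
    proof (rule closedin_continuous_maps_eq)
      show "Hausdorff_space X" using \<rho> by (simp add: right_action_def)
      show "continuous_map ?P X (\<lambda>x. \<rho> s (x g))"
        using continuous_map_compose[OF continuous_map_product_projection[OF g] cont[OF s]]
        by (simp add: o_def)
      show "continuous_map ?P X (\<lambda>x. x (g \<otimes>\<^bsub>G\<^esub> j s))"
        using g s by (intro continuous_map_product_projection) simp
    qed
  qed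
  \<comment> \<open>The relations at \<open>k\<close> determine \<open>x\<close> on all
    \<open>k \<otimes> j s\<close>, and by the action law they contain those at
    \<open>g = k \<otimes> j s\<close>; invariance of \<open>Y\<close> carries membership from
    \<open>Y k\<close> to \<open>Y g\<close>.\<close>
  have mono: "A k \<subseteq> A g" if k: "k \<in> carrier G" "s \<in> carrier S" and g: "g = k \<otimes>\<^bsub>G\<^esub> j s" for k s g
  proof
    fix x assume x: "x \<in> A k"
    have xk: "x \<in> topspace ?P" "x k \<in> Y k"
      "\<And>t. t \<in> carrier S \<Longrightarrow> \<rho> t (x k) = x (k \<otimes>\<^bsub>G\<^esub> j t)"
      using x S.one_closed by (auto simp: A_def)
    have xX: "x k \<in> topspace X" using xk(1) k by (auto simp: PiE_iff)
    have xg: "x g = \<rho> s (x k)" using xk(3) k g by simp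
    then have "x g \<in> Y g" using xk(2) inv[OF k] g by blast
    moreover have "\<rho> t (x g) = x (g \<otimes>\<^bsub>G\<^esub> j t)" if t: "t \<in> carrier S" for t
    proof -
      have "\<rho> t (x g) = \<rho> (s \<otimes>\<^bsub>S\<^esub> t) (x k)"
        using \<rho> k t xX by (simp add: xg right_action_def)
      also have "\<dots> = x (k \<otimes>\<^bsub>G\<^esub> j (s \<otimes>\<^bsub>S\<^esub> t))" using xk(3) k t by simp
      also have "\<dots> = x (g \<otimes>\<^bsub>G\<^esub> j t)" using k t by (simp add: g j_mult G.m_assoc)
      finally show ?thesis .
    qed
    ultimately show "x \<in> A g" using xk(1) by (auto simp: A_def)
  qed
  have nonempty: "A k \<noteq> {}" if k: "k \<in> carrier G" for k
  proof -
    obtain y where y: "y \<in> Y k" using Y(2) k by blast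
    have yX: "y \<in> topspace X" using y Y(1)[OF k] closedin_subset by blast
    \<comment> \<open>A point \<open>y\<close> of \<open>Y k\<close> is pushed forward along the
      transition maps. The description operator is well defined because \<open>j\<close> is
      injective and \<open>k\<close> cancels; at indices not of the form
      \<open>k \<otimes> j s\<close> the value \<open>y\<close> is a mere filler in
      \<open>topspace X\<close>.\<close>
    define x where "x = (\<lambda>g\<in>carrier G. if \<exists>s\<in>carrier S. g = k \<otimes>\<^bsub>G\<^esub> j s
      then \<rho> (THE s. s \<in> carrier S \<and> g = k \<otimes>\<^bsub>G\<^esub> j s) y else y)"
    have xs: "x (k \<otimes>\<^bsub>G\<^esub> j s) = \<rho> s y" if s: "s \<in> carrier S" for s
    proof -
      have "(THE t. t \<in> carrier S \<and> k \<otimes>\<^bsub>G\<^esub> j s = k \<otimes>\<^bsub>G\<^esub> j t) = s"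
        using s k by (intro the_equality) (auto simp: j_inj)
      then show ?thesis using s k by (auto simp: x_def)
    qed
    have xk: "x k = y"
      using xs[OF S.one_closed] \<rho> yX k by (simp add: j_one right_action_def)
    have "x g \<in> topspace X" if g: "g \<in> carrier G" for g
    proof (cases "\<exists>s\<in>carrier S. g = k \<otimes>\<^bsub>G\<^esub> j s")
      case True
      then show ?thesis
        using xs yX cont continuous_map_image_subset_topspace by (fastforce simp: image_subset_iff)
    next
      case False
      then show ?thesis using g yX by (simp add: x_def)
    qed
    then have "x \<in> topspace ?P" by (auto simp: x_def)
    then have "x \<in> A k" using xk y xs by (simp add: A_def)
    then show ?thesis by blast
  qed
  have "compact_space ?P"
    using \<rho> by (simp add: compact_space_product_topology right_action_def)
  moreover have "\<forall>C\<in>A ` carrier G. closedin ?P C" using closed by blast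
  moreover have "\<Inter>\<F> \<noteq> {}" if \<F>: "finite \<F>" "\<F> \<subseteq> A ` carrier G" for \<F>
  proof -
    obtain B where B: "B \<subseteq> carrier G" "finite B" "\<F> = A ` B"
      using finite_subset_image[OF \<F>] by blast
    obtain k where "k \<in> carrier G" "\<forall>g\<in>B. \<exists>s\<in>carrier S. g = k \<otimes>\<^bsub>G\<^esub> j s"
      using common_lower_bound B by blast
    \<comment> \<open>The index \<open>k\<close> dominates every index in \<open>B\<close>, so the
      nonempty set \<open>A k\<close> lies in the whole finite intersection.\<close>
    then have "A k \<subseteq> \<Inter>\<F>" using mono B by blast
    then show ?thesis using nonempty \<open>k \<in> carrier G\<close> by blast
  qed
  ultimately have "\<Inter>(A ` carrier G) \<noteq> {}"
    unfolding compact_space_fip by meson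
  then obtain x where "\<And>g. g \<in> carrier G \<Longrightarrow> x \<in> A g" by blast
  moreover from this have "x \<in> topspace (colocal_space S G j X \<rho>)"
    unfolding topspace_colocal_space using G.one_closed by (fastforce simp: A_def)
  ultimately show ?thesis
    by (auto simp: A_def)
qed

section \<open>Functoriality of the colocalization\<close>

lemma colocal_map_closed:
  assumes \<phi>: "\<phi> ` topspace X \<subseteq> topspace Y" "equivariant S X \<rho> \<sigma> \<phi>"
    and x: "x \<in> topspace (colocal_space S G j X \<rho>)"
  shows "colocal_map G \<phi> x \<in> topspace (colocal_space S G j Y \<sigma>)"
  unfolding topspace_colocal_space
proof (intro conjI ballI)
  show "colocal_map G \<phi> x \<in> carrier G \<rightarrow>\<^sub>E topspace Y"
    using \<phi>(1) x by (auto simp: topspace_colocal_space colocal_map_def)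
  fix g s assume gs: "g \<in> carrier G" "s \<in> carrier S"
  have "x g \<in> topspace X" "\<rho> s (x g) = x (g \<otimes>\<^bsub>G\<^esub> j s)"
    using x gs by (auto simp: topspace_colocal_space)
  then show "\<sigma> s (colocal_map G \<phi> x g) = colocal_map G \<phi> x (g \<otimes>\<^bsub>G\<^esub> j s)"
    using \<phi>(2) gs by (fastforce simp: equivariant_def colocal_map_def)
qed

text \<open>\<open>colocal_map\<close> changes values and \<open>colocal_action\<close> permutes
  indices, so they commute.\<close>

lemma equivariant_colocal_map:
  "equivariant G (colocal_space S G j X \<rho>) (colocal_action G) (colocal_action G) (colocal_map G \<phi>)"
  by (auto simp: equivariant_def colocal_map_def colocal_action_def fun_eq_iff)

lemma continuous_colocal_map:
  assumes \<phi>: "continuous_map X Y \<phi>" "equivariant S X \<rho> \<sigma> \<phi>"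
  shows "continuous_map (colocal_space S G j X \<rho>) (colocal_space S G j Y \<sigma>) (colocal_map G \<phi>)"
proof (rule continuous_map_into_colocal_space)
  show "colocal_map G \<phi> x \<in> topspace (colocal_space S G j Y \<sigma>)"
    if "x \<in> topspace (colocal_space S G j X \<rho>)" for x
    using colocal_map_closed[OF continuous_map_image_subset_topspace[OF \<phi>(1)] \<phi>(2) that] .
  show "continuous_map (colocal_space S G j X \<rho>) Y (\<lambda>x. colocal_map G \<phi> x g)"
    if "g \<in> carrier G" for g
    using continuous_map_compose[OF continuous_map_colocal_eval \<phi>(1)] that
    by (simp add: colocal_map_def o_def)
qed

end

section \<open>Compact groups: products, closed subgroups and coset spaces\<close>

lemma (in group) l_coset_eq_iff:
  assumes "subgroup H G" "a \<in> carrier G" "b \<in> carrier G"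
  shows "a <# H = b <# H \<longleftrightarrow> inv a \<otimes> b \<in> H"
  using assms
  by (metis is_group l_repr_independence lcos_self subgroup.lcos_module_imp subgroup.lcos_module_rev)

text \<open>Compactness is the Tychonoff theorem, and the group operations are continuous because
  each coordinate of them is. The ambient group of the colocalization arises as a power of
  \<open>K\<close> in this way.\<close>

lemma compact_group_product:
  assumes "\<And>i. i \<in> I \<Longrightarrow> compact_group (K i) (T i)"
  shows "compact_group (product_group I K) (product_topology T I)"
proof -
  let ?P = "product_topology T I"
  have grp: "group (K i)" if "i \<in> I" for i using assms that by (simp add: compact_group_def)
  have top: "topspace (T i) = carrier (K i)" if "i \<in> I" for i
    using compact_group.topspace_eq[OF assms[OF that]] .
  interpret P: group "product_group I K" using grp by (rule product_group)
  show ?thesis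
  proof
    show carrier: "topspace ?P = carrier (product_group I K)"
      using top by (auto simp: PiE_iff)
    show "compact_space ?P"
      by (simp add: compact_space_product_topology compact_group.compact[OF assms])
    show "Hausdorff_space ?P"
      by (simp add: Hausdorff_space_product_topology compact_group.Hausdorff[OF assms])
    have "continuous_map (prod_topology ?P ?P) (T i) ((\<lambda>(a, b). a \<otimes>\<^bsub>K i\<^esub> b) \<circ> (\<lambda>z. (fst z i, snd z i)))"
      if i: "i \<in> I" for i
    proof (rule continuous_map_compose[OF _ compact_group.continuous_mult[OF assms[OF i]]])
      have "continuous_map ?P (T i) (\<lambda>x. x i)" using i by (rule continuous_map_product_projection)
      from continuous_map_compose[OF continuous_map_fst[of ?P ?P] this]
        continuous_map_compose[OF continuous_map_snd[of ?P ?P] this]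
      show "continuous_map (prod_topology ?P ?P) (prod_topology (T i) (T i)) (\<lambda>z. (fst z i, snd z i))"
        by (simp add: continuous_map_paired o_def)
    qed
    then show "continuous_map (prod_topology ?P ?P) ?P (\<lambda>(x, y). x \<otimes>\<^bsub>product_group I K\<^esub> y)"
      by (auto simp: continuous_map_componentwise o_def case_prod_unfold)
    have "continuous_map ?P (T i) ((\<lambda>a. inv\<^bsub>K i\<^esub> a) \<circ> (\<lambda>x. x i))" if i: "i \<in> I" for i
      using continuous_map_product_projection[OF i] compact_group.continuous_inv[OF assms[OF i]]
      by (rule continuous_map_compose)
    then have "continuous_map ?P ?P (\<lambda>x. \<lambda>i\<in>I. inv\<^bsub>K i\<^esub> x i)"
      by (auto simp: continuous_map_componentwise o_def)
    \<comment> \<open>The inverse of the product group is computed coordinatewise only on its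
      carrier, hence the transfer by equality on the topological space.\<close>
    then show "continuous_map ?P ?P (\<lambda>x. inv\<^bsub>product_group I K\<^esub> x)"
    proof (rule continuous_map_eq)
      fix x assume "x \<in> topspace ?P"
      then show "(\<lambda>i\<in>I. inv\<^bsub>K i\<^esub> x i) = inv\<^bsub>product_group I K\<^esub> x"
        using grp carrier by (subst inv_product_group) auto
    qed
  qed
qed

context compact_group
begin

lemma compact_group_subgroup:
  assumes H: "subgroup H K" "closedin T H"
  shows "compact_group (K\<lparr>carrier := H\<rparr>) (subtopology T H)"
proof -
  interpret H: subgroup H K by fact
  interpret KH: group "K\<lparr>carrier := H\<rparr>" using H(1) is_group by (rule subgroup.subgroup_is_group)
  have top: "topspace (subtopology T H) = H"
    using H(2) closedin_subset by (auto simp: Int_absorb1)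
  show ?thesis
  proof
    show "topspace (subtopology T H) = carrier (K\<lparr>carrier := H\<rparr>)" using top by simp
    show "compact_space (subtopology T H)"
      using closedin_compact_space[OF compact H(2)] by (rule compact_space_subtopology)
    show "Hausdorff_space (subtopology T H)" using Hausdorff by (rule Hausdorff_space_subtopology)
    have "continuous_map (subtopology (prod_topology T T) (H \<times> H)) T (\<lambda>(x, y). x \<otimes> y)"
      using continuous_mult by (rule continuous_map_from_subtopology)
    then show "continuous_map (prod_topology (subtopology T H) (subtopology T H)) (subtopology T H)
        (\<lambda>(x, y). x \<otimes>\<^bsub>K\<lparr>carrier := H\<rparr>\<^esub> y)"
      by (auto simp: continuous_map_in_subtopology subtopology_Times[symmetric])
    have "continuous_map (subtopology T H) (subtopology T H) (\<lambda>x. inv x)"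
      using continuous_map_from_subtopology[OF continuous_inv] top
      by (auto simp: continuous_map_in_subtopology)
    then show "continuous_map (subtopology T H) (subtopology T H) (\<lambda>x. inv\<^bsub>K\<lparr>carrier := H\<rparr>\<^esub> x)"
      by (rule continuous_map_eq) (use H(1) top in auto)
  qed
qed

lemma continuous_right_translation:
  assumes "h \<in> carrier K"
  shows "continuous_map T T (\<lambda>k. k \<otimes> h)"
proof -
  have "continuous_map T (prod_topology T T) (\<lambda>k. (k, h))"
    using assms by (simp add: continuous_map_paired topspace_eq)
  from continuous_map_compose[OF this continuous_mult] show ?thesis
    by (simp add: o_def)
qed

text \<open>The union of the cosets that meet an open \<open>U\<close> is the union of the right
  translates of \<open>U\<close> by inverses of elements of \<open>H\<close>, each of them the
  preimage of \<open>U\<close> under \<open>k \<mapsto> k \<otimes> h\<close>.\<close>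

lemma open_map_coset_projection:
  assumes H: "subgroup H K"
  shows "open_map T (coset_space K T H) (\<lambda>k. k <# H)"
  unfolding open_map_def
proof (intro allI impI)
  fix U assume U: "openin T U"
  then have UK: "U \<subseteq> carrier K" using openin_subset topspace_eq by blast
  have HK: "H \<subseteq> carrier K" using H by (rule subgroup.subset)
  have "{k \<in> topspace T. k <# H \<in> (\<lambda>k. k <# H) ` U} = (\<Union>h\<in>H. {k \<in> topspace T. k \<otimes> h \<in> U})"
  proof (intro equalityI subsetI)
    fix k assume "k \<in> {k \<in> topspace T. k <# H \<in> (\<lambda>k. k <# H) ` U}"
    then obtain u where k: "k \<in> carrier K" and u: "u \<in> U" "k <# H = u <# H"
      by (auto simp: topspace_eq)
    then have "u \<in> k <# H" using lcos_self[OF _ H] UK by auto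
    then obtain h where "h \<in> H" "u = k \<otimes> h" by (auto simp: l_coset_def)
    then show "k \<in> (\<Union>h\<in>H. {k \<in> topspace T. k \<otimes> h \<in> U})" using k u by (auto simp: topspace_eq)
  next
    fix k assume "k \<in> (\<Union>h\<in>H. {k \<in> topspace T. k \<otimes> h \<in> U})"
    then obtain h where h: "h \<in> H" "k \<in> carrier K" "k \<otimes> h \<in> U" by (auto simp: topspace_eq)
    have "k <# H = (k \<otimes> h) <# H"
      using h by (intro l_repr_independence[OF _ _ H]) (auto simp: l_coset_def)
    then show "k \<in> {k \<in> topspace T. k <# H \<in> (\<lambda>k. k <# H) ` U}" using h by (auto simp: topspace_eq)
  qed
  moreover have "openin T {k \<in> topspace T. k \<otimes> h \<in> U}" if "h \<in> H" for h
    using continuous_right_translation U that HK by (auto simp: continuous_map_def)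
  ultimately show "openin (coset_space K T H) ((\<lambda>k. k <# H) ` U)"
    using UK by (auto simp: openin_coset_space LCOSETS_def intro!: openin_Union)
qed

text \<open>Distinct cosets \<open>a <# H\<close> and \<open>b <# H\<close> mean that
  \<open>inv a \<otimes> b\<close> avoids the closed set \<open>H\<close>. This persists on an open
  box \<open>U \<times> V\<close> around \<open>(a, b)\<close>, and the projections of
  \<open>U\<close> and \<open>V\<close> are then disjoint, and open since the projection is an open
  map.\<close>

lemma Hausdorff_coset_space:
  assumes H: "subgroup H K" "closedin T H"
  shows "Hausdorff_space (coset_space K T H)"
  unfolding Hausdorff_space_def
proof (intro allI impI, elim conjE)
  fix A B assume "A \<in> topspace (coset_space K T H)" "B \<in> topspace (coset_space K T H)" and AB: "A \<noteq> B"
  then obtain a b where a: "a \<in> carrier K" "A = a <# H" and b: "b \<in> carrier K" "B = b <# H"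
    by (auto simp: topspace_coset_space[OF topspace_eq] LCOSETS_def)
  let ?f = "\<lambda>z. inv (fst z) \<otimes> snd z"
  let ?TT = "prod_topology T T"
  let ?D = "{z \<in> topspace ?TT. ?f z \<in> H}"
  have "continuous_map ?TT T ((\<lambda>(x, y). x \<otimes> y) \<circ> (\<lambda>z. (inv (fst z), snd z)))"
    using continuous_map_compose[OF continuous_map_fst continuous_inv]
    by (intro continuous_map_compose[OF _ continuous_mult])
      (simp add: continuous_map_paired continuous_map_snd o_def)
  then have "continuous_map ?TT T ?f" by (simp add: o_def)
  then have "closedin ?TT ?D"
    using H(2) by (rule closedin_continuous_map_preimage)
  then have "openin ?TT (topspace ?TT - ?D)" by blast
  then have *: "\<exists>U V. openin T U \<and> openin T V \<and> x \<in> U \<and> y \<in> V \<and> U \<times> V \<subseteq> topspace ?TT - ?D"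
    if "(x, y) \<in> topspace ?TT - ?D" for x y
    using that by (simp only: openin_prod_topology_alt)
  have "(a, b) \<in> topspace ?TT - ?D"
    using a b AB l_coset_eq_iff[OF H(1)] by (auto simp: topspace_eq)
  from *[OF this] obtain U V where UV: "openin T U" "openin T V" "a \<in> U" "b \<in> V"
    and sub: "U \<times> V \<subseteq> topspace ?TT - ?D"
    by (elim exE conjE)
  have "u <# H \<noteq> v <# H" if "u \<in> U" "v \<in> V" for u v
  proof -
    have "(u, v) \<in> topspace ?TT - ?D" using sub that by blast
    then show ?thesis using l_coset_eq_iff[OF H(1)] by (auto simp: topspace_eq)
  qed
  then have "disjnt ((\<lambda>k. k <# H) ` U) ((\<lambda>k. k <# H) ` V)"
    by (auto simp: disjnt_iff)
  moreover have "openin (coset_space K T H) ((\<lambda>k. k <# H) ` U)" "openin (coset_space K T H) ((\<lambda>k. k <# H) ` V)"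
    using open_map_coset_projection[OF H(1)] UV by (auto simp: open_map_def)
  ultimately show "\<exists>U V. openin (coset_space K T H) U \<and> openin (coset_space K T H) V \<and> A \<in> U \<and> B \<in> V \<and> disjnt U V"
    using UV a b by blast
qed

lemma compact_coset_space: "compact_space (coset_space K T H)"
proof -
  have q: "quotient_map T (coset_space K T H) (\<lambda>k. k <# H)"
    using topspace_eq by (rule quotient_map_coset_space)
  have "compactin (coset_space K T H) ((\<lambda>k. k <# H) ` topspace T)"
    using compact quotient_imp_continuous_map[OF q] by (simp add: image_compactin compact_space_def)
  then show ?thesis
    using quotient_imp_surjective_map[OF q] by (simp add: compact_space_def)
qed

end

section \<open>Actions induced on an invariant closed subgroup and on its cosets\<close>

lemma right_group_action_restrict:
  assumes S: "monoid S" and \<rho>: "right_group_action S K T \<rho>"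
    and H: "subgroup H K" "closedin T H" "action_invariant S \<rho> H"
  shows "right_group_action S (K\<lparr>carrier := H\<rparr>) (subtopology T H) (restrict_action \<rho> H)"
proof -
  interpret compact_group K T using \<rho> by (simp add: right_group_action_def)
  interpret KH: compact_group "K\<lparr>carrier := H\<rparr>" "subtopology T H"
    using H(1,2) by (rule compact_group_subgroup)
  have top: "topspace (subtopology T H) = H" using KH.topspace_eq by simp
  have HK: "H \<subseteq> carrier K" using H(1) by (rule subgroup.subset)
  have inv: "\<rho> s x \<in> H" if "s \<in> carrier S" "x \<in> H" for s x
    using H(3) that by (auto simp: action_invariant_def)
  have act: "right_action S T \<rho>" and hom: "\<And>s. s \<in> carrier S \<Longrightarrow> \<rho> s \<in> hom K K"
    using \<rho> by (auto simp: right_group_action_def)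
  have "right_action S (subtopology T H) (restrict_action \<rho> H)"
    unfolding right_action_def
  proof (intro conjI ballI)
    fix s assume s: "s \<in> carrier S"
    have "continuous_map (subtopology T H) (subtopology T H) (\<rho> s)"
      using act s inv by (auto simp: right_action_def continuous_map_in_subtopology top
          intro: continuous_map_from_subtopology)
    then show "continuous_map (subtopology T H) (subtopology T H) (restrict_action \<rho> H s)"
      by (rule continuous_map_eq) (simp add: restrict_action_def top)
  qed (use act S HK inv in \<open>auto simp: KH.compact KH.Hausdorff right_action_def restrict_action_def top
      topspace_eq monoid.m_closed\<close>)
  moreover have "restrict_action \<rho> H s \<in> hom (K\<lparr>carrier := H\<rparr>) (K\<lparr>carrier := H\<rparr>)" if "s \<in> carrier S" for s
    using hom[OF that] inv[OF that] HK subgroup.m_closed[OF H(1)]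
    by (auto simp: hom_def restrict_action_def subset_iff)
  ultimately show ?thesis
    by (simp add: right_group_action_def KH.compact_group_axioms)
qed

text \<open>On representatives the induced maps are those of \<open>\<rho>\<close>, by
  \<open>coset_action_coset\<close>; the action laws follow, and continuity descends along the
  quotient map.\<close>

lemma right_action_coset_space:
  assumes S: "monoid S" and \<rho>: "right_group_action S K T \<rho>"
    and H: "subgroup H K" "closedin T H" "action_invariant S \<rho> H"
  shows "right_action S (coset_space K T H) (coset_action K H \<rho>)"
proof -
  interpret S: monoid S by fact
  interpret compact_group K T using \<rho> by (simp add: right_group_action_def)
  have act: "right_action S T \<rho>" and hom: "\<And>s. s \<in> carrier S \<Longrightarrow> \<rho> s \<in> hom K K"
    using \<rho> by (auto simp: right_group_action_def)
  have coset: "coset_action K H \<rho> s (k <#\<^bsub>K\<^esub> H) = \<rho> s k <#\<^bsub>K\<^esub> H"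
    if "s \<in> carrier S" "k \<in> carrier K" for s k
    using that H hom by (intro coset_action_coset) (auto simp: action_invariant_def is_group)
  have \<rho>K: "\<rho> s k \<in> carrier K" if "s \<in> carrier S" "k \<in> carrier K" for s k
    using hom[OF that(1)] that(2) by (rule hom_in_carrier)
  have q: "quotient_map T (coset_space K T H) (\<lambda>k. k <#\<^bsub>K\<^esub> H)"
    using topspace_eq by (rule quotient_map_coset_space)
  show ?thesis
    unfolding right_action_def topspace_coset_space[OF topspace_eq]
  proof (intro conjI ballI)
    show "compact_space (coset_space K T H)" by (rule compact_coset_space)
    show "Hausdorff_space (coset_space K T H)" using H(1,2) by (rule Hausdorff_coset_space)
  next
    fix s assume s: "s \<in> carrier S"
    have "continuous_map T (coset_space K T H) ((\<lambda>k. k <#\<^bsub>K\<^esub> H) \<circ> \<rho> s)"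
      using act s
      by (intro continuous_map_compose[OF _ quotient_imp_continuous_map[OF q]])
        (simp add: right_action_def)
    then have "continuous_map T (coset_space K T H) (coset_action K H \<rho> s \<circ> (\<lambda>k. k <#\<^bsub>K\<^esub> H))"
      by (rule continuous_map_eq) (simp add: coset s topspace_eq)
    with q show "continuous_map (coset_space K T H) (coset_space K T H) (coset_action K H \<rho> s)"
      by (rule continuous_compose_quotient_map)
  next
    fix A assume "A \<in> lcosets\<^bsub>K\<^esub> H"
    then obtain k where k: "k \<in> carrier K" "A = k <#\<^bsub>K\<^esub> H" by (auto simp: LCOSETS_def)
    show "coset_action K H \<rho> \<one>\<^bsub>S\<^esub> A = A"
      using act k by (simp add: coset right_action_def topspace_eq)
    show "coset_action K H \<rho> (s \<otimes>\<^bsub>S\<^esub> t) A = coset_action K H \<rho> t (coset_action K H \<rho> s A)"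
      if "s \<in> carrier S" "t \<in> carrier S" for s t
      using act k that by (simp add: coset \<rho>K right_action_def topspace_eq)
  qed
qed

section \<open>Colocalization of compact groups and of their subgroups\<close>

context left_fractions
begin

text \<open>Since every \<open>\<rho> s\<close> is an endomorphism, the compatible families form a
  subgroup of the power of \<open>K\<close>; it is closed, hence a compact group. Shifts of indices
  respect the coordinatewise product.\<close>

lemma right_group_action_colocal:
  assumes \<rho>: "right_group_action S K T \<rho>"
  shows "right_group_action G (colocal_group S G j K T \<rho>) (colocal_space S G j T \<rho>) (colocal_action G)"
proof -
  let ?P = "product_group (carrier G) (\<lambda>_. K)"
  let ?X = "topspace (colocal_space S G j T \<rho>)"
  interpret compact_group K T using \<rho> by (simp add: right_group_action_def)
  have act: "right_action S T \<rho>" and hom: "\<And>s. s \<in> carrier S \<Longrightarrow> \<rho> s \<in> hom K K"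
    using \<rho> by (auto simp: right_group_action_def)
  interpret P: compact_group ?P "product_topology (\<lambda>_. T) (carrier G)"
    by (intro compact_group_product compact_group_axioms)
  have gh: "group_hom K K (\<rho> s)" if "s \<in> carrier S" for s
    using hom[OF that] by (intro group_hom.intro) (auto simp: group_hom_axioms_def is_group)
  note colocal = topspace_colocal_space topspace_eq
  have "subgroup ?X ?P"
  proof (rule P.subgroupI)
    show sub: "?X \<subseteq> carrier ?P" by (auto simp: colocal)
    have "(\<lambda>g\<in>carrier G. \<one>\<^bsub>K\<^esub>) \<in> ?X"
      using gh[THEN group_hom.hom_one] by (auto simp: colocal)
    then show "?X \<noteq> {}" by blast
    fix x y assume x: "x \<in> ?X" and y: "y \<in> ?X"
    have xy: "x g \<in> carrier K" "y g \<in> carrier K" if "g \<in> carrier G" for g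
      using x y that by (auto simp: colocal)
    have "inv\<^bsub>?P\<^esub> x = (\<lambda>g\<in>carrier G. inv\<^bsub>K\<^esub> x g)"
      using x by (intro inv_product_group) (auto simp: colocal is_group)
    moreover have "(\<lambda>g\<in>carrier G. inv\<^bsub>K\<^esub> x g) \<in> ?X"
      using x xy gh[THEN group_hom.hom_inv] by (auto simp: colocal)
    ultimately show "inv\<^bsub>?P\<^esub> x \<in> ?X" by simp
    show "x \<otimes>\<^bsub>?P\<^esub> y \<in> ?X"
      using x y xy hom[THEN hom_mult] by (auto simp: colocal)
  qed
  then have "compact_group (?P\<lparr>carrier := ?X\<rparr>) (subtopology (product_topology (\<lambda>_. T) (carrier G)) ?X)"
    using closedin_colocal_space[OF act] by (rule P.compact_group_subgroup)
  moreover have "subtopology (product_topology (\<lambda>_. T) (carrier G)) ?X = colocal_space S G j T \<rho>"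
    unfolding colocal_space_eq topspace_subtopology subtopology_restrict ..
  ultimately have "compact_group (colocal_group S G j K T \<rho>) (colocal_space S G j T \<rho>)"
    by (simp add: colocal_group_def)
  moreover have "colocal_action G g \<in> hom (colocal_group S G j K T \<rho>) (colocal_group S G j K T \<rho>)"
    if "g \<in> carrier G" for g
    using that colocal_action_closed[OF that, of _ T \<rho>]
    by (auto simp: hom_def colocal_group_def) (auto simp: colocal_action_def fun_eq_iff)
  ultimately show ?thesis
    using right_action_colocal[OF act] by (simp add: right_group_action_def)
qed

text \<open>On families with values in \<open>H\<close> the restricted action and
  \<open>\<rho>\<close> impose the same relations. As \<open>colocal_space_eq\<close> removes the
  cores, those of \<open>H\<close> and of the whole space never have to be compared.\<close>

lemma colocal_space_restrict:
  assumes H: "H \<subseteq> topspace T" "action_invariant S \<rho> H"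
  shows "colocal_space S G j (subtopology T H) (restrict_action \<rho> H) =
    subtopology (colocal_space S G j T \<rho>) (carrier G \<rightarrow>\<^sub>E H)"
proof -
  let ?C = "\<lambda>\<rho>. {x. \<forall>g\<in>carrier G. \<forall>s\<in>carrier S. \<rho> s (x g) = x (g \<otimes>\<^bsub>G\<^esub> j s)}"
  have "(carrier G \<rightarrow>\<^sub>E H) \<inter> ?C (restrict_action \<rho> H) = ?C \<rho> \<inter> (carrier G \<rightarrow>\<^sub>E H)"
    by (auto simp: restrict_action_def PiE_iff)
  then show ?thesis
    unfolding colocal_space_eq subtopology_product_topology[symmetric] subtopology_subtopology by simp
qed

lemma colocal_group_restrict:
  assumes H: "H \<subseteq> topspace T" "action_invariant S \<rho> H"
  shows "colocal_group S G j (K\<lparr>carrier := H\<rparr>) (subtopology T H) (restrict_action \<rho> H) =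
    (colocal_group S G j K T \<rho>)\<lparr>carrier := topspace (colocal_space S G j T \<rho>) \<inter> (carrier G \<rightarrow>\<^sub>E H)\<rparr>"
  by (simp add: colocal_group_def colocal_space_restrict[OF H] product_group_def)

text \<open>Members of the colocalization are extensional on \<open>carrier G\<close>, so the
  restriction inside \<open>colocal_map\<close> leaves them unchanged. This makes
  \<open>\<iota>_star\<close> a literal inclusion.\<close>

lemma colocal_map_ident:
  "x \<in> topspace (colocal_space S G j X \<rho>) \<Longrightarrow> colocal_map G (\<lambda>k. k) x = x"
  by (auto simp: topspace_colocal_space colocal_map_def PiE_iff extensional_restrict)

end

section \<open>Colocalizing the inclusion of a subgroup and the projection to its cosets\<close>

theorem corollary3p14:
  fixes S :: "('s, 'm) monoid_scheme"
    and I :: "'i set" and preceq :: "'i \<Rightarrow> 'i \<Rightarrow> bool" and F :: "'i \<Rightarrow> 's set"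
    and G :: "('g, 'n) monoid_scheme" and j :: "'s \<Rightarrow> 'g"
    and K :: "('k, 'p) monoid_scheme" and T :: "'k topology"
    and \<rho> :: "'s \<Rightarrow> 'k \<Rightarrow> 'k" and H :: "'k set"
  assumes cancellative: "monoid_cancel S"
    and right_amenable: "right_Folner_net S I preceq F"
    and fractions: "group_of_left_fractions S G j"
    and action: "right_group_action S K T \<rho>"
    and subgroup: "subgroup H K"
    and closed: "closedin T H"
    and invariant: "action_invariant S \<rho> H"
  defines "\<rho>H \<equiv> restrict_action \<rho> H"
    and "\<rho>KH \<equiv> coset_action K H \<rho>"
    and "\<iota> \<equiv> (\<lambda>h::'k. h)"
    and "\<pi> \<equiv> (\<lambda>k::'k. k <#\<^bsub>K\<^esub> H)"
  defines "K_star \<equiv> colocal_group S G j K T \<rho>"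
    and "T_star \<equiv> colocal_space S G j T \<rho>"
    and "H_star \<equiv> colocal_group S G j (K\<lparr>carrier := H\<rparr>) (subtopology T H) \<rho>H"
    and "TH_star \<equiv> colocal_space S G j (subtopology T H) \<rho>H"
    and "KH_star \<equiv> colocal_space S G j (coset_space K T H) \<rho>KH"
    and "\<rho>_star \<equiv> (colocal_action G :: 'g \<Rightarrow> ('g \<Rightarrow> 'k) \<Rightarrow> ('g \<Rightarrow> 'k))"
    and "\<rho>H_star \<equiv> (colocal_action G :: 'g \<Rightarrow> ('g \<Rightarrow> 'k) \<Rightarrow> ('g \<Rightarrow> 'k))"
    and "\<rho>KH_star \<equiv> (colocal_action G :: 'g \<Rightarrow> ('g \<Rightarrow> 'k set) \<Rightarrow> ('g \<Rightarrow> 'k set))"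
    and "\<iota>_star \<equiv> colocal_map G \<iota>"
    and "\<pi>_star \<equiv> colocal_map G \<pi>"
  defines "H_img \<equiv> \<iota>_star ` carrier H_star"
  shows
    "(inj_on \<iota>_star (carrier H_star) \<and>
      equivariant G TH_star \<rho>H_star \<rho>_star \<iota>_star \<and>
      continuous_map TH_star T_star \<iota>_star \<and>
      closed_map TH_star T_star \<iota>_star \<and>
      \<iota>_star \<in> hom H_star K_star \<and>
      group_conjugated G H_star TH_star \<rho>H_star
        (K_star\<lparr>carrier := H_img\<rparr>) (subtopology T_star H_img) (restrict_action \<rho>_star H_img))
     \<and>
     (\<pi>_star ` topspace T_star = topspace KH_star \<and>
      equivariant G T_star \<rho>_star \<rho>KH_star \<pi>_star \<and>
      continuous_map T_star KH_star \<pi>_star \<and>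
      open_map T_star KH_star \<pi>_star \<and>
      conjugated G KH_star \<rho>KH_star
        (coset_space K_star T_star H_img) (coset_action K_star H_img \<rho>_star))"
proof -
  interpret S: monoid S using cancellative by (rule monoid_cancel.axioms)
  interpret group G using fractions by (simp add: group_of_left_fractions_def)
  interpret left_fractions S G j using fractions by unfold_locales
  interpret K: compact_group K T using action by (simp add: right_group_action_def)
  have act: "right_action S T \<rho>" and hom: "\<And>s. s \<in> carrier S \<Longrightarrow> \<rho> s \<in> hom K K"
    using action by (auto simp: right_group_action_def)
  have HT: "H \<subseteq> topspace T" using closed by (rule closedin_subset)

  have star: "right_group_action G K_star T_star \<rho>_star"
    unfolding K_star_def T_star_def \<rho>_star_def using action by (rule right_group_action_colocal)
  interpret Ks: compact_group K_star T_star using star by (simp add: right_group_action_def)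
  have top_star: "topspace T_star = carrier K_star" by (rule Ks.topspace_eq)
  have mult_star: "x \<otimes>\<^bsub>K_star\<^esub> y = (\<lambda>g\<in>carrier G. x g \<otimes>\<^bsub>K\<^esub> y g)" for x y
    by (simp add: K_star_def colocal_group_def)
  have eval: "x g \<in> carrier K" if "x \<in> carrier K_star" "g \<in> carrier G" for x g
    using that by (auto simp: top_star[symmetric] T_star_def topspace_colocal_space K.topspace_eq)

  have starH: "right_group_action G H_star TH_star \<rho>H_star"
    unfolding H_star_def TH_star_def \<rho>H_star_def \<rho>H_def
    using right_group_action_restrict[OF S.monoid_axioms action subgroup closed invariant]
    by (rule right_group_action_colocal)
  have TH_star: "TH_star = subtopology T_star (carrier G \<rightarrow>\<^sub>E H)"
    unfolding TH_star_def T_star_def \<rho>H_def using HT invariant by (rule colocal_space_restrict)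
  have H_star: "H_star = K_star\<lparr>carrier := topspace T_star \<inter> (carrier G \<rightarrow>\<^sub>E H)\<rparr>"
    unfolding H_star_def K_star_def T_star_def \<rho>H_def using HT invariant by (rule colocal_group_restrict)
  have \<iota>_star: "\<iota>_star x = x" if "x \<in> carrier H_star" for x
    using that colocal_map_ident by (auto simp: H_star \<iota>_star_def \<iota>_def T_star_def)
  have H_img: "H_img = topspace T_star \<inter> (carrier G \<rightarrow>\<^sub>E H)"
    using \<iota>_star by (simp add: H_img_def H_star)
  have mem_H_img: "x \<in> H_img \<longleftrightarrow> x \<in> carrier K_star \<and> (\<forall>g\<in>carrier G. x g \<in> H)" for x
    by (auto simp: H_img PiE_iff top_star[symmetric] T_star_def topspace_colocal_space)
  have TH_eq: "TH_star = subtopology T_star H_img"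
    unfolding TH_star H_img subtopology_restrict ..
  have H_eq: "H_star = K_star\<lparr>carrier := H_img\<rparr>"
    unfolding H_star H_img ..
  have top_H: "topspace TH_star = H_img" by (auto simp: TH_eq H_img)

  \<comment> \<open>By \<open>H_eq\<close>, the group structure known for \<open>H_star\<close> is
    the one on \<open>H_img\<close> with the operation of \<open>K_star\<close>.\<close>
  have subgroup_img: "subgroup H_img K_star"
  proof (rule Ks.group_incl_imp_subgroup)
    show "H_img \<subseteq> carrier K_star" by (auto simp: mem_H_img)
    show "group (K_star\<lparr>carrier := H_img\<rparr>)"
      using starH by (simp add: H_eq right_group_action_def compact_group_def)
  qed
  \<comment> \<open>\<open>H_img\<close> carries the compact topology \<open>TH_star\<close> as a
    subspace of a Hausdorff space.\<close>
  have closed_img: "closedin T_star H_img"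
  proof -
    have "compactin T_star H_img"
      using starH top_H by (auto simp: TH_eq right_group_action_def right_action_def compactin_subspace H_img)
    then show ?thesis using Ks.Hausdorff by (simp add: compactin_imp_closedin)
  qed
  \<comment> \<open>\<open>\<rho>_star\<close> and \<open>\<rho>H_star\<close> are the same index
    shift, which maps \<open>topspace TH_star\<close> into itself.\<close>
  have invariant_img: "action_invariant G \<rho>_star H_img"
    using starH top_H
    by (auto simp: action_invariant_def right_group_action_def right_action_def \<rho>_star_def \<rho>H_star_def
        dest!: continuous_map_image_subset_topspace)

  have part1: "inj_on \<iota>_star (carrier H_star) \<and>
      equivariant G TH_star \<rho>H_star \<rho>_star \<iota>_star \<and>
      continuous_map TH_star T_star \<iota>_star \<and>
      closed_map TH_star T_star \<iota>_star \<and>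
      \<iota>_star \<in> hom H_star K_star \<and>
      group_conjugated G H_star TH_star \<rho>H_star
        (K_star\<lparr>carrier := H_img\<rparr>) (subtopology T_star H_img) (restrict_action \<rho>_star H_img)"
  proof (intro conjI)
    \<comment> \<open>Each topological claim about \<open>\<iota>_star\<close> is reduced to the
      inclusion of the closed subgroup \<open>H_img\<close>; the conjugacy below is witnessed by
      \<open>id\<close> itself.\<close>
    have id: "\<iota>_star x = id x" if "x \<in> topspace TH_star" for x
      using that \<iota>_star by (simp add: top_H H_eq)
    show "inj_on \<iota>_star (carrier H_star)" using \<iota>_star by (simp add: inj_on_def)
    show "equivariant G TH_star \<rho>H_star \<rho>_star \<iota>_star"
      unfolding TH_star_def \<rho>H_star_def \<rho>_star_def \<iota>_star_def by (rule equivariant_colocal_map)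
    have "continuous_map TH_star T_star id"
      unfolding TH_eq by (simp add: continuous_map_from_subtopology)
    then show "continuous_map TH_star T_star \<iota>_star"
      by (rule continuous_map_eq) (simp add: id)
    have "closed_map TH_star T_star id"
      unfolding TH_eq using closed_img by (rule closed_map_inclusion)
    then show "closed_map TH_star T_star \<iota>_star"
      by (rule closed_map_eq) (simp add: id)
    show "\<iota>_star \<in> hom H_star K_star"
      using \<iota>_star subgroup.m_closed[OF subgroup_img] by (auto simp: hom_def H_eq mem_H_img)
    show "group_conjugated G H_star TH_star \<rho>H_star
        (K_star\<lparr>carrier := H_img\<rparr>) (subtopology T_star H_img) (restrict_action \<rho>_star H_img)"
      unfolding group_conjugated_def
    proof (intro conjI exI)
      show "right_group_action G H_star TH_star \<rho>H_star" by (rule starH)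
      show "right_group_action G (K_star\<lparr>carrier := H_img\<rparr>) (subtopology T_star H_img)
          (restrict_action \<rho>_star H_img)"
        using monoid_axioms star subgroup_img closed_img invariant_img by (rule right_group_action_restrict)
      show "id \<in> iso H_star (K_star\<lparr>carrier := H_img\<rparr>)"
        by (simp add: H_eq id_iso)
      show "homeomorphic_map TH_star (subtopology T_star H_img) id"
        by (simp add: TH_eq)
      show "equivariant G TH_star \<rho>H_star (restrict_action \<rho>_star H_img) id"
        by (simp add: equivariant_def top_H restrict_action_def \<rho>H_star_def \<rho>_star_def)
    qed
  qed

  have act_KH: "right_action S (coset_space K T H) \<rho>KH"
    unfolding \<rho>KH_def using S.monoid_axioms action subgroup closed invariant by (rule right_action_coset_space)
  have quot: "quotient_map T (coset_space K T H) \<pi>"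
    unfolding \<pi>_def using K.topspace_eq by (rule quotient_map_coset_space)
  have equiv_\<pi>: "equivariant S T \<rho> \<rho>KH \<pi>"
    using invariant
    by (simp add: equivariant_def \<rho>KH_def \<pi>_def K.topspace_eq action_invariant_def
        coset_action_coset[OF K.is_group subgroup hom])
  have cont_\<pi>_star: "continuous_map T_star KH_star \<pi>_star"
    unfolding T_star_def KH_star_def \<pi>_star_def
    using quotient_imp_continuous_map[OF quot] equiv_\<pi> by (rule continuous_colocal_map)
  have equiv_\<pi>_star: "equivariant G T_star \<rho>_star \<rho>KH_star \<pi>_star"
    unfolding T_star_def \<rho>_star_def \<rho>KH_star_def \<pi>_star_def by (rule equivariant_colocal_map)
  have act_KH_star: "right_action G KH_star \<rho>KH_star"
    unfolding KH_star_def \<rho>KH_star_def using act_KH by (rule right_action_colocal)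

  have surj: "\<pi>_star ` topspace T_star = topspace KH_star"
  proof
    show "\<pi>_star ` topspace T_star \<subseteq> topspace KH_star"
      using cont_\<pi>_star by (rule continuous_map_image_subset_topspace)
    show "topspace KH_star \<subseteq> \<pi>_star ` topspace T_star"
    proof
      fix y assume "y \<in> topspace KH_star"
      then have y: "y \<in> carrier G \<rightarrow>\<^sub>E topspace (coset_space K T H)"
        and y_compat: "\<And>g s. g \<in> carrier G \<Longrightarrow> s \<in> carrier S \<Longrightarrow> \<rho>KH s (y g) = y (g \<otimes>\<^bsub>G\<^esub> j s)"
        by (auto simp: KH_star_def topspace_colocal_space)
      \<comment> \<open>\<open>Y g\<close> is the coset \<open>y g\<close> viewed as a fibre of
        \<open>\<pi>\<close>. It is closed because points of the Hausdorff coset space are closed,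
        and compatibility of \<open>y\<close> is what makes the fibres invariant as
        \<open>colocal_selection\<close> requires.\<close>
      define Y where "Y g = {k \<in> topspace T. \<pi> k = y g}" for g
      have "closedin T (Y g)" if g: "g \<in> carrier G" for g
      proof -
        have "closedin (coset_space K T H) {y g}"
          using act_KH y g by (intro closedin_Hausdorff_singleton) (auto simp: right_action_def)
        from closedin_continuous_map_preimage[OF quotient_imp_continuous_map[OF quot] this]
        show ?thesis by (simp add: Y_def)
      qed
      moreover have "Y g \<noteq> {}" if g: "g \<in> carrier G" for g
      proof -
        have "y g \<in> \<pi> ` topspace T"
          using PiE_mem[OF y g] quotient_imp_surjective_map[OF quot] by simp
        then show ?thesis by (auto simp: Y_def)
      qed
      moreover have "\<rho> s ` Y g \<subseteq> Y (g \<otimes>\<^bsub>G\<^esub> j s)" if gs: "g \<in> carrier G" "s \<in> carrier S" for g s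
      proof (rule image_subsetI)
        fix k assume "k \<in> Y g"
        then have k: "k \<in> carrier K" "\<pi> k = y g" by (simp_all add: Y_def K.topspace_eq)
        then have "\<pi> (\<rho> s k) = y (g \<otimes>\<^bsub>G\<^esub> j s)"
          using equiv_\<pi> y_compat[OF gs] gs by (simp add: equivariant_def K.topspace_eq)
        then show "\<rho> s k \<in> Y (g \<otimes>\<^bsub>G\<^esub> j s)"
          using hom_in_carrier[OF hom[OF gs(2)] k(1)] by (simp add: Y_def K.topspace_eq)
      qed
      ultimately have "\<exists>x\<in>topspace T_star. \<forall>g\<in>carrier G. x g \<in> Y g"
        unfolding T_star_def by (rule colocal_selection[OF act])
      then obtain x where x: "x \<in> topspace T_star" "\<And>g. g \<in> carrier G \<Longrightarrow> x g \<in> Y g"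
        by blast
      have "\<pi>_star x = y"
        using x(2) y by (auto simp: \<pi>_star_def colocal_map_def Y_def PiE_iff extensional_def fun_eq_iff)
      with x(1) show "y \<in> \<pi>_star ` topspace T_star" by blast
    qed
  qed

  define q where "q x = x <#\<^bsub>K_star\<^esub> H_img" for x
  have quot_star: "quotient_map T_star (coset_space K_star T_star H_img) q"
    unfolding q_def using top_star by (rule quotient_map_coset_space)
  \<comment> \<open>Equality of cosets is tested by \<open>inv x \<otimes> y\<close>, and membership
    in \<open>H_img\<close> is tested coordinatewise, which gives equality of the cosets of
    \<open>x g\<close> and \<open>y g\<close> for all \<open>g\<close>.\<close>
  have fibres: "q x = q y \<longleftrightarrow> \<pi>_star x = \<pi>_star y" if xy: "x \<in> topspace T_star" "y \<in> topspace T_star" for x y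
  proof -
    let ?z = "inv\<^bsub>K_star\<^esub> x \<otimes>\<^bsub>K_star\<^esub> y"
    have x: "x \<in> carrier K_star" and y: "y \<in> carrier K_star" using xy top_star by auto
    have z: "?z \<in> carrier K_star" using x y by simp
    have zg: "?z g = inv\<^bsub>K\<^esub> x g \<otimes>\<^bsub>K\<^esub> y g" if g: "g \<in> carrier G" for g
    proof -
      \<comment> \<open>The coordinates of \<open>?z\<close> are read off from this equation by
        solving in \<open>K\<close>, which bypasses a formula for inverses in
        \<open>K_star\<close>.\<close>
      have "x \<otimes>\<^bsub>K_star\<^esub> ?z = y" using x y by (simp add: Ks.m_assoc[symmetric])
      then have "x g \<otimes>\<^bsub>K\<^esub> ?z g = y g" using fun_cong[OF mult_star[of x ?z], of g] g by simp
      then show ?thesis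
        using eval[OF x g] eval[OF y g] eval[OF z g] by (simp add: K.inv_solve_left)
    qed
    have "q x = q y \<longleftrightarrow> ?z \<in> H_img"
      unfolding q_def using subgroup_img x y by (rule Ks.l_coset_eq_iff)
    also have "\<dots> \<longleftrightarrow> (\<forall>g\<in>carrier G. inv\<^bsub>K\<^esub> x g \<otimes>\<^bsub>K\<^esub> y g \<in> H)"
      using z zg by (simp add: mem_H_img)
    also have "\<dots> \<longleftrightarrow> (\<forall>g\<in>carrier G. \<pi> (x g) = \<pi> (y g))"
      unfolding \<pi>_def using K.l_coset_eq_iff[OF subgroup] eval x y by simp
    also have "\<dots> \<longleftrightarrow> \<pi>_star x = \<pi>_star y"
      by (auto simp: \<pi>_star_def colocal_map_def fun_eq_iff)
    finally show ?thesis .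
  qed
  \<comment> \<open>One direction of \<open>fibres\<close> lets \<open>\<pi>_star\<close> descend
    along \<open>q\<close>; the other gives injectivity of \<open>\<theta>\<close> in the proof of
    \<open>homeo\<close>.\<close>
  obtain \<theta> where \<theta>: "continuous_map (coset_space K_star T_star H_img) KH_star \<theta>"
      "\<theta> ` topspace (coset_space K_star T_star H_img) = \<pi>_star ` topspace T_star"
      "\<And>x. x \<in> topspace T_star \<Longrightarrow> \<theta> (q x) = \<pi>_star x"
    using quotient_map_lift_exists[OF quot_star cont_\<pi>_star] fibres by metis
  have q_top: "topspace (coset_space K_star T_star H_img) = q ` topspace T_star"
    using quotient_imp_surjective_map[OF quot_star] by simp
  have homeo: "homeomorphic_map (coset_space K_star T_star H_img) KH_star \<theta>"
    using \<theta>(1) Ks.compact_coset_space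
  proof (rule continuous_imp_homeomorphic_map)
    show "Hausdorff_space KH_star" using act_KH_star by (simp add: right_action_def)
    show "\<theta> ` topspace (coset_space K_star T_star H_img) = topspace KH_star"
      using \<theta>(2) surj by simp
    show "inj_on \<theta> (topspace (coset_space K_star T_star H_img))"
      using \<theta>(3) fibres by (auto simp: inj_on_def q_top)
  qed
  \<comment> \<open>\<open>\<pi>_star\<close> agrees with \<open>\<theta> \<circ> q\<close>, a group
    coset projection followed by a homeomorphism, and both are open maps.\<close>
  have open_\<pi>_star: "open_map T_star KH_star \<pi>_star"
  proof (rule open_map_eq)
    show "open_map T_star KH_star (\<theta> \<circ> q)"
      unfolding q_def using Ks.open_map_coset_projection[OF subgroup_img] homeomorphic_imp_open_map[OF homeo]
      by (rule open_map_compose)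
  qed (simp add: \<theta>(3))
  have coset_star: "coset_action K_star H_img \<rho>_star g (q x) = q (\<rho>_star g x)"
    if "g \<in> carrier G" "x \<in> topspace T_star" for g x
    unfolding q_def using that star invariant_img subgroup_img Ks.is_group
    by (intro coset_action_coset) (auto simp: right_group_action_def action_invariant_def top_star)
  have equiv_\<theta>: "equivariant G (coset_space K_star T_star H_img) (coset_action K_star H_img \<rho>_star) \<rho>KH_star \<theta>"
    unfolding equivariant_def q_top
  proof (intro ballI, elim imageE, hypsubst)
    fix g x assume gx: "g \<in> carrier G" "x \<in> topspace T_star"
    have "\<rho>_star g x \<in> topspace T_star"
      unfolding \<rho>_star_def T_star_def using gx by (auto simp: T_star_def intro: colocal_action_closed)
    then show "\<theta> (coset_action K_star H_img \<rho>_star g (q x)) = \<rho>KH_star g (\<theta> (q x))"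
      using gx equiv_\<pi>_star by (simp add: coset_star \<theta>(3) equivariant_def)
  qed
  \<comment> \<open>The conjugacy is stated from \<open>KH_star\<close> to the coset space, so the
    inverse of \<open>\<theta>\<close> is needed; it inherits equivariance.\<close>
  obtain \<theta>' where \<theta>': "homeomorphic_maps (coset_space K_star T_star H_img) KH_star \<theta> \<theta>'"
    using homeo homeomorphic_map_maps by blast
  have act_coset: "right_action G (coset_space K_star T_star H_img) (coset_action K_star H_img \<rho>_star)"
    using monoid_axioms star subgroup_img closed_img invariant_img by (rule right_action_coset_space)
  have "equivariant G KH_star \<rho>KH_star (coset_action K_star H_img \<rho>_star) \<theta>'"
    unfolding equivariant_def
  proof (intro ballI)
    fix g y assume g: "g \<in> carrier G" and y: "y \<in> topspace KH_star"
    have 1: "\<theta>' y \<in> topspace (coset_space K_star T_star H_img)" "\<theta> (\<theta>' y) = y"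
      using \<theta>' y by (auto simp: homeomorphic_maps_def continuous_map_def)
    have 2: "coset_action K_star H_img \<rho>_star g (\<theta>' y) \<in> topspace (coset_space K_star T_star H_img)"
      using act_coset g 1(1) by (auto simp: right_action_def continuous_map_def)
    have "\<rho>KH_star g y = \<theta> (coset_action K_star H_img \<rho>_star g (\<theta>' y))"
      using equiv_\<theta> g 1 by (simp add: equivariant_def)
    then show "\<theta>' (\<rho>KH_star g y) = coset_action K_star H_img \<rho>_star g (\<theta>' y)"
      using \<theta>' 2 by (simp add: homeomorphic_maps_def)
  qed
  then have "conjugated G KH_star \<rho>KH_star
        (coset_space K_star T_star H_img) (coset_action K_star H_img \<rho>_star)"
    using \<theta>' act_KH_star act_coset unfolding conjugated_def homeomorphic_maps_map by blast
  with part1 surj equiv_\<pi>_star cont_\<pi>_star open_\<pi>_star show ?thesis by blast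
qed

end
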